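(* For each Borel probability measure $\mu$ on $H$ there exists a consistent family $(C_k)_{k\in\mathbb{N}}$ of copulas $C_k$ in $\mathbb{R}^k$ satisfying, for all $k\in\mathbb{N}$ and all $I_1,\dots,I_k\in\mathcal{I}$, $$\mu\circ\pi_{e_1,\dots,e_k}^{-1}\big(I_1\times\cdots\times I_k\big)=C_k\big(\mu_1(I_1),\dots,\mu_k(I_k)\big),$$ where $\mu_j:=\mu\circ\pi_{e_j}^{-1}$. If $\mu\in\mathcal{M}^c(H)$, then the consistent family of copulas $(C_k)_{k\in\mathbb{N}}$ with this property is unique.
   Context: $H$ is a separable (real, infinite dimensional) Hilbert space with inner product $\langle\cdot,\cdot\rangle$ and a fixed orthonormal basis $(e_k)_{k\in\mathbb{N}}$, $\mathbb{N}=\{1,2,\dots\}$. For $k\le\ell$, $\pi_{e_k,\dots,e_\ell}\colon H\to\mathbb{R}^{\ell-k+1}$, $\pi_{e_k,\dots,e_\ell}(h)=(\langle h,e_k\rangle,\dots,\langle h,e_\ell\rangle)$. $\mathcal{I}:=\{(-\infty,x]:x\in\mathbb{R}\}$. $\mathcal{M}^c(H)$ is the set of Borel probability measures $\mu$ on $H$ such that for every $k\in\mathbb{N}$ the function $x\mapsto\mu\circ\pi_{e_k}^{-1}((-\infty,x])$ is continuous. A copula in $\mathbb{R}^k$ is a cumulative distribution function $C_k\colon[0,1]^k\to[0,1]$ (i.e. the restriction to $[0,1]^k$ of the distribution function of a probability measure on $[0,1]^k$) with uniform marginals: $C_k(1,\dots,1,u_j,1,\dots,1)=u_j$ for all $u_j\in[0,1]$,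 $j\in\{1,\dots,k\}$. A family $(C_k)_{k\in\mathbb{N}}$ of copulas $C_k$ in $\mathbb{R}^k$ is called consistent if for all $k\in\mathbb{N}$: $C_{k+1}(u_1,\dots,u_k,1)=C_k(u_1,\dots,u_k)$ for all $u_1,\dots,u_k\in[0,1]$. *)

theory Defs
  imports "HOL-Probability.Probability"
begin

text \<open>
  The Hilbert space is a type of sort \<open>{real_inner, complete_space, second_countable_topology}\<close>;
  it is infinite dimensional because it carries an orthonormal basis indexed by the positive
  integers. As \<open>\<nat> = {1, 2, \<dots>}\<close> here, the value of a sequence at \<open>0\<close> is never used.
\<close>

definition orthonormal_basis :: "(nat \<Rightarrow> 'h::{real_inner, complete_space, second_countable_topology}) \<Rightarrow> bool" where
  "orthonormal_basis e \<longleftrightarrow>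
     (\<forall>i\<ge>1. \<forall>j\<ge>1. e i \<bullet> e j = (if i = j then 1 else 0)) \<and>
     closure (span (e ` {1..})) = UNIV"

definition borel_prob :: "'h::topological_space measure \<Rightarrow> bool" where
  "borel_prob \<mu> \<longleftrightarrow> prob_space \<mu> \<and> sets \<mu> = sets borel"

text \<open>Points of \<open>\<real>\<^sup>k\<close> are extensional functions on \<open>{1..k}\<close>.\<close>

definition proj :: "(nat \<Rightarrow> 'h::real_inner) \<Rightarrow> nat \<Rightarrow> 'h \<Rightarrow> nat \<Rightarrow> real" where
  "proj e k h = (\<lambda>j\<in>{1..k}. h \<bullet> e j)"

definition joint_law :: "(nat \<Rightarrow> 'h::real_inner) \<Rightarrow> 'h measure \<Rightarrow> nat \<Rightarrow> (nat \<Rightarrow> real) measure" where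
  "joint_law e \<mu> k = distr \<mu> (Pi\<^sub>M {1..k} (\<lambda>_. borel)) (proj e k)"

definition marginal :: "(nat \<Rightarrow> 'h::real_inner) \<Rightarrow> 'h measure \<Rightarrow> nat \<Rightarrow> real measure" where
  "marginal e \<mu> j = distr \<mu> borel (\<lambda>h. h \<bullet> e j)"

definition lower_rays :: "real set set" where
  "lower_rays = {{..x} | x. True}"

definition continuous_marginal_measures :: "(nat \<Rightarrow> 'h::real_inner) \<Rightarrow> 'h measure set" where
  "continuous_marginal_measures e =
     {\<mu>. borel_prob \<mu> \<and> (\<forall>k\<ge>1. continuous_on UNIV (\<lambda>x. measure (marginal e \<mu> k) {..x}))}"

definition unit_cube :: "nat \<Rightarrow> (nat \<Rightarrow> real) set" where
  "unit_cube k = {1..k} \<rightarrow>\<^sub>E {0..1}"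

text \<open>
  A function on \<open>[0,1]\<^sup>k\<close> is represented by a total function of which only the values on
  \<open>unit_cube k\<close> matter.
\<close>

definition copula :: "nat \<Rightarrow> ((nat \<Rightarrow> real) \<Rightarrow> real) \<Rightarrow> bool" where
  "copula k C \<longleftrightarrow>
     (\<exists>M. prob_space M \<and> sets M = sets (Pi\<^sub>M {1..k} (\<lambda>_. restrict_space borel {0..1::real})) \<and>
          (\<forall>u\<in>unit_cube k. C u = measure M {x \<in> space M. \<forall>j\<in>{1..k}. x j \<le> u j})) \<and>
     (\<forall>j\<in>{1..k}. \<forall>t\<in>{0..1}. C (\<lambda>i\<in>{1..k}. if i = j then t else 1) = t)"

definition consistent_copulas :: "(nat \<Rightarrow> (nat \<Rightarrow> real) \<Rightarrow> real) \<Rightarrow> bool" where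
  "consistent_copulas C \<longleftrightarrow>
     (\<forall>k\<ge>1. copula k (C k)) \<and>
     (\<forall>k\<ge>1. \<forall>u\<in>unit_cube k. C (Suc k) (u(Suc k := 1)) = C k u)"

definition copulas_of :: "(nat \<Rightarrow> 'h::real_inner) \<Rightarrow> 'h measure \<Rightarrow> (nat \<Rightarrow> (nat \<Rightarrow> real) \<Rightarrow> real) \<Rightarrow> bool" where
  "copulas_of e \<mu> C \<longleftrightarrow>
     (\<forall>k\<ge>1. \<forall>I. (\<forall>j\<in>{1..k}. I j \<in> lower_rays) \<longrightarrow>
        measure (joint_law e \<mu> k) (Pi\<^sub>E {1..k} I) =
        C k (\<lambda>j\<in>{1..k}. measure (marginal e \<mu> j) (I j)))"

end

theory Submission imports Defs begin

text \<open>
  Existence (Sklar's theorem by randomization): let \<open>V\<close> be uniform on \<open>[0,1]\<close> and independent of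
  \<open>X \<sim> \<mu>\<close>. With \<open>F\<^sub>j\<close> the distribution function of \<open>X\<^sub>j = \<langle>X, e\<^sub>j\<rangle>\<close>, the random variables
  \<open>U\<^sub>j = F\<^sub>j(X\<^sub>j-) + V (F\<^sub>j(X\<^sub>j) - F\<^sub>j(X\<^sub>j-))\<close>, all built from the same \<open>V\<close>, are uniform, and
  \<open>{U\<^sub>j \<le> F\<^sub>j(x)}\<close> coincides almost surely with \<open>{X\<^sub>j \<le> x}\<close>, since the former event contains the
  latter and has the same probability. So the laws of \<open>(U\<^sub>1, \<dots>, U\<^sub>k)\<close> are the required copulas.

  Uniqueness: if the \<open>F\<^sub>j\<close> are continuous they attain all values in \<open>(0,1)\<close>, so the copulas are
  determined on the open cube, and copulas are Lipschitz continuous on the closed cube.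
\<close>

section \<open>The distributional transform and quantiles\<close>

definition distributional_transform :: "real measure \<Rightarrow> real \<Rightarrow> real \<Rightarrow> real" where
  "distributional_transform D x v = measure D {..<x} + v * measure D {x}"

abbreviation unit_lebesgue :: "real measure" where
  "unit_lebesgue \<equiv> restrict_space lborel {0..1}"

lemma prob_space_unit_lebesgue: "prob_space unit_lebesgue"
  by (intro prob_space_restrict_space) auto

lemma measurable_unit_lebesgue_ident[measurable]: "(\<lambda>x. x) \<in> borel_measurable unit_lebesgue"
  by (simp add: measurable_restrict_space1)

context real_distribution
begin

lemma cdf_eq_less_plus_singleton: "cdf M x = measure M {..<x} + measure M {x}"
  unfolding cdf_def ivl_disj_un(2)[symmetric] by (subst finite_measure_Union) auto

lemma cdf_le_measure_lessThan: "x < y \<Longrightarrow> cdf M x \<le> measure M {..<y}"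
  unfolding cdf_def by (intro finite_measure_mono) auto

lemma distributional_transform_ge:
  "0 \<le> v \<Longrightarrow> measure M {..<x} \<le> distributional_transform M x v"
  by (simp add: distributional_transform_def)

lemma distributional_transform_le:
  "v \<le> 1 \<Longrightarrow> distributional_transform M x v \<le> cdf M x"
  using mult_right_mono[of v 1 "measure M {x}"]
  by (simp add: distributional_transform_def cdf_eq_less_plus_singleton)

lemma distributional_transform_in_unit:
  assumes "v \<in> {0..1}" shows "distributional_transform M x v \<in> {0..1}"
  using assms distributional_transform_le[of v x] cdf_bounded_prob[of x]
  by (auto simp: distributional_transform_def)

text \<open>The mass of the atom at a point is the cdf minus its left limit there, a difference of
  two monotone functions and hence Borel measurable.\<close>

lemma measurable_distributional_transform[measurable]:
  assumes [measurable]: "f \<in> borel_measurable N" "g \<in> borel_measurable N"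
  shows "(\<lambda>z. distributional_transform M (f z) (g z)) \<in> borel_measurable N"
proof -
  have [measurable]: "(\<lambda>x. measure M {..<x}) \<in> borel_measurable borel"
    by (intro borel_measurable_mono monoI finite_measure_mono) auto
  have [measurable]: "cdf M \<in> borel_measurable borel"
    by (intro borel_measurable_mono monoI cdf_nondecreasing)
  have "distributional_transform M (f z) (g z) =
      measure M {..<f z} + g z * (cdf M (f z) - measure M {..<f z})" for z
    by (simp add: distributional_transform_def cdf_eq_less_plus_singleton)
  then show ?thesis by simp
qed

lemma quantile:
  assumes "0 < t" "t < 1"
  obtains q where "\<And>x. t \<le> cdf M x \<longleftrightarrow> q \<le> x" "measure M {..<q} \<le> t"
proof -
  \<comment> \<open>This provides the generalized inverse \<open>I t\<close>, the infimum of all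
    \<open>x\<close> with \<open>t \<le> cdf M x\<close>; by right continuity the infimum is
    attained.\<close>
  interpret cdf_distribution M by unfold_locales
  have q: "t \<le> cdf M x \<longleftrightarrow> I t \<le> x" for x
    using assms by (intro pseudoinverse) auto
  \<comment> \<open>The left side is the left limit of the cdf at \<open>I t\<close>, and the cdf is
    below \<open>t\<close> everywhere to the left of \<open>I t\<close>.\<close>
  have "measure M {..<I t} \<le> t"
  proof (rule tendsto_upperbound[OF cdf_at_left])
    show "eventually (\<lambda>x. cdf M x \<le> t) (at_left (I t))"
      unfolding eventually_at_filter by (rule always_eventually) (metis q lessThan_iff nle_le not_le)
  qed simp
  with q show thesis by (rule that)
qed

end

section \<open>Products with the unit interval\<close>

lemma measure_pair_Times:
  assumes "prob_space M" "prob_space L" "A \<in> sets M" "B \<in> sets L"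
  shows "measure (M \<Otimes>\<^sub>M L) (A \<times> B) = measure M A * measure L B"
proof -
  interpret L: prob_space L by fact
  show ?thesis
    using assms by (simp add: measure_def L.emeasure_pair_measure_Times enn2real_mult)
qed

lemma measure_Times_unit:
  assumes "prob_space M" "A \<in> sets M"
  shows "measure (M \<Otimes>\<^sub>M unit_lebesgue) (A \<times> {0..1}) = measure M A"
proof -
  have "{0..1} \<in> sets unit_lebesgue" by (simp add: sets_restrict_space_iff)
  then show ?thesis
    using assms by (simp add: measure_pair_Times prob_space_unit_lebesgue measure_restrict_space)
qed

section \<open>Uniformity of the distributional transform\<close>

context prob_space
begin

context
  fixes X :: "'a \<Rightarrow> real" and D N
  assumes X[measurable]: "random_variable borel X"
  defines "D \<equiv> distr M borel X" and "N \<equiv> M \<Otimes>\<^sub>M unit_lebesgue"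
begin

interpretation D: real_distribution D
  unfolding D_def by (intro real_distribution_distr X)

interpretation N: prob_space N
  unfolding N_def by (intro prob_space_pair prob_space_unit_lebesgue prob_space_axioms)

lemma measurable_uniformized[measurable]:
  "(\<lambda>z. distributional_transform D (X (fst z)) (snd z)) \<in> borel_measurable N"
  unfolding N_def by measurable

lemma space_N: "space N = space M \<times> {0..1}"
  by (simp add: N_def space_pair_measure space_restrict_space)

text \<open>For \<open>q\<close> the \<open>t\<close>-quantile, this event lies between \<open>{U < t}\<close> and \<open>{U \<le> t}\<close>, where \<open>U\<close> is the
  distributional transform.\<close>

lemma prob_split_at_atom:
  assumes q: "measure D {..<q} \<le> t" "t \<le> cdf D q"
  shows "measure N {z\<in>space N. X (fst z) < q \<or> X (fst z) = q \<and>
           snd z * measure D {q} \<le> t - measure D {..<q}} = t"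
    (is "measure N ?E = t")
proof -
  define a b where "a = measure D {..<q}" and "b = measure D {q}"
  have ab: "a \<le> t" "t \<le> a + b" "0 \<le> b"
    using q by (auto simp: a_def b_def D.cdf_eq_less_plus_singleton)
  define A B where "A = {x\<in>space M. X x < q}" and "B = {x\<in>space M. X x = q}"
  define W where "W = {v\<in>{0..1}. v * b \<le> t - a}"
  have [measurable]: "A \<in> sets M" "B \<in> sets M" by (auto simp: A_def B_def)
  have a_eq: "a = measure M A" and b_eq: "b = measure M B"
    unfolding a_def b_def D_def A_def B_def
    by (subst measure_distr; auto intro!: arg_cong[where f=prob])+
  have [measurable]: "W \<in> sets unit_lebesgue"
    unfolding W_def sets_restrict_space image_iff
    by (intro bexI[of _ "{v. v * b \<le> t - a}"]) (auto simp: sets_lborel)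
  \<comment> \<open>\<open>B \<times> W\<close> must supply exactly the mass \<open>t - a\<close>
    missing from \<open>A \<times> {0..1}\<close>, so \<open>W\<close> is an initial segment of
    length \<open>(t - a) / b\<close>. Without an atom at \<open>q\<close> the bounds on
    \<open>t\<close> force \<open>t = a\<close>.\<close>
  have mW: "b * measure unit_lebesgue W = t - a"
  proof (cases "b = 0")
    case False
    then have "b > 0" using ab by simp
    then have le: "(t - a) / b \<le> 1" "0 \<le> (t - a) / b"
      using ab by (auto simp: divide_simps)
    have "W = {0..(t - a) / b}"
      using le \<open>b > 0\<close> by (auto simp: W_def pos_le_divide_eq[symmetric] intro: order.trans)
    then show ?thesis
      using le \<open>b > 0\<close> by (simp add: measure_restrict_space)
  qed (use ab in auto)
  have E: "?E = A \<times> {0..1} \<union> B \<times> W"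
    by (auto simp: space_N A_def B_def W_def a_def b_def)
  have I: "{0..1} \<in> sets unit_lebesgue" by (simp add: sets_restrict_space_iff)
  have "measure N ?E = measure N (A \<times> {0..1}) + measure N (B \<times> W)"
    unfolding E using I
    by (intro N.finite_measure_Union) (auto simp: N_def A_def B_def)
  also have "\<dots> = a + b * measure unit_lebesgue W"
    unfolding N_def using a_eq b_eq
    by (simp add: measure_Times_unit measure_pair_Times prob_space_axioms prob_space_unit_lebesgue)
  finally show ?thesis using mW by simp
qed

text \<open>Both bounds compare with the event of probability exactly \<open>t\<close> from
  \<open>prob_split_at_atom\<close>, taken at the quantile. The second inclusion may be strict:
  \<open>U = t\<close> also occurs beyond the quantile where the cdf is flat at level
  \<open>t\<close>.\<close>

lemma uniformized_bounds:
  assumes "0 < t" "t < 1"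
  shows "measure N {z\<in>space N. distributional_transform D (X (fst z)) (snd z) < t} \<le> t"
    and "t \<le> measure N {z\<in>space N. distributional_transform D (X (fst z)) (snd z) \<le> t}"
proof -
  obtain q where q: "\<And>x. t \<le> cdf D x \<longleftrightarrow> q \<le> x" "measure D {..<q} \<le> t"
    using D.quantile[OF assms] by blast
  let ?E = "{z\<in>space N. X (fst z) < q \<or> X (fst z) = q \<and>
           snd z * measure D {q} \<le> t - measure D {..<q}}"
  have E: "measure N ?E = t"
    using q by (intro prob_split_at_atom) auto
  have [measurable]: "?E \<in> sets N" unfolding N_def by measurable
  have "z \<in> ?E" if z: "z \<in> space N" "distributional_transform D (X (fst z)) (snd z) < t" for z
  proof (cases "X (fst z) < q")
    case False
    \<comment> \<open>Beyond \<open>q\<close> the transform is at least the left limit of the cdf,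
      which is at least \<open>cdf D q\<close> and hence at least \<open>t\<close>.\<close>
    have "\<not> q < X (fst z)"
    proof
      assume "q < X (fst z)"
      then have "t \<le> measure D {..<X (fst z)}"
        using D.cdf_le_measure_lessThan q(1)[of q] by fastforce
      with z show False
        using D.distributional_transform_ge[of "snd z" "X (fst z)"] by (auto simp: space_N)
    qed
    with False have "X (fst z) = q" by simp
    with z show ?thesis by (simp add: distributional_transform_def)
  qed (use z in auto)
  then have "{z\<in>space N. distributional_transform D (X (fst z)) (snd z) < t} \<subseteq> ?E" by blast
  then show "measure N {z\<in>space N. distributional_transform D (X (fst z)) (snd z) < t} \<le> t"
    using E N.finite_measure_mono[of _ ?E] by simp
  have "distributional_transform D (X (fst z)) (snd z) \<le> t" if z: "z \<in> ?E" for z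
  proof (cases "X (fst z) < q")
    case True
    then have "cdf D (X (fst z)) < t" using q(1)[of "X (fst z)"] by auto
    then show ?thesis
      using D.distributional_transform_le[of "snd z" "X (fst z)"] z by (auto simp: space_N)
  qed (use z in \<open>auto simp: distributional_transform_def\<close>)
  then have "?E \<subseteq> {z\<in>space N. distributional_transform D (X (fst z)) (snd z) \<le> t}" by blast
  then show "t \<le> measure N {z\<in>space N. distributional_transform D (X (fst z)) (snd z) \<le> t}"
    using E N.finite_measure_mono[of ?E] by simp
qed

text \<open>For the upper bound, \<open>{U \<le> t}\<close> lies in \<open>{U < s}\<close> for every
  \<open>s\<close> strictly between \<open>t\<close> and 1, so its probability is at most
  \<open>s\<close>; then \<open>s\<close> decreases to \<open>t\<close>. This covers
  \<open>t = 0\<close> too, where \<open>uniformized_bounds\<close> does not apply directly.\<close>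

lemma uniformized_uniform:
  assumes t: "t \<in> {0..1}"
  shows "measure N {z\<in>space N. distributional_transform D (X (fst z)) (snd z) \<le> t} = t"
    (is "?P t = t")
proof (rule antisym)
  show "t \<le> ?P t"
  proof (cases "0 < t \<and> t < 1")
    case False
    then consider "t = 0" | "t = 1" using t by fastforce
    then show ?thesis
    proof cases
      case 2
      then have "{z\<in>space N. distributional_transform D (X (fst z)) (snd z) \<le> t} = space N"
        using D.distributional_transform_in_unit by (auto simp: space_N)
      then show ?thesis using N.prob_space 2 by simp
    qed simp
  qed (use uniformized_bounds in auto)
  show "?P t \<le> t"
  proof (cases "t = 1")
    case False
    show ?thesis
    proof (rule dense_ge_bounded)
      show "t < 1" using t False by auto
      fix s assume s: "t < s" "s < 1"
      have "?P t \<le> measure N {z\<in>space N. distributional_transform D (X (fst z)) (snd z) < s}"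
        using s by (intro N.finite_measure_mono) auto
      also have "\<dots> \<le> s" using s t by (intro uniformized_bounds) auto
      finally show "?P t \<le> s" .
    qed
  qed simp
qed

text \<open>\<open>X \<le> x\<close> implies \<open>U \<le> cdf D X \<le> cdf D x\<close>, and by
  uniformity both events have probability \<open>cdf D x\<close>, so they differ by a null set. This
  null set may depend on \<open>x\<close>.\<close>

lemma AE_uniformized_le_cdf_iff:
  "AE z in N. distributional_transform D (X (fst z)) (snd z) \<le> cdf D x \<longleftrightarrow> X (fst z) \<le> x"
proof -
  let ?U = "{z\<in>space N. distributional_transform D (X (fst z)) (snd z) \<le> cdf D x}"
  let ?X = "{z\<in>space N. X (fst z) \<le> x}"
  have [measurable]: "?X \<in> sets N" unfolding N_def by measurable
  have sub: "?X \<subseteq> ?U"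
    by (auto simp: space_N intro!: order.trans[OF D.distributional_transform_le D.cdf_nondecreasing])
  have "?X = {h\<in>space M. X h \<le> x} \<times> {0..1}"
    by (auto simp: space_N)
  then have "measure N ?X = measure M {h\<in>space M. X h \<le> x}"
    unfolding N_def by (simp only:) (intro measure_Times_unit prob_space_axioms; measurable)
  also have "\<dots> = cdf D x"
    unfolding cdf_def D_def by (subst measure_distr) (auto intro!: arg_cong[where f=prob])
  also have "\<dots> = measure N ?U"
    using uniformized_uniform[of "cdf D x"] D.cdf_nonneg D.cdf_bounded_prob by auto
  finally have "measure N (?U - ?X) = 0"
    using sub by (subst N.finite_measure_Diff) auto
  then have "AE z in N. z \<notin> ?U - ?X"
    by (subst (asm) N.prob_eq_0) auto
  then show ?thesis
    using AE_space by eventually_elim (use sub in auto)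
qed

end

end

section \<open>Lipschitz continuity of copulas\<close>

text \<open>A point in the box below \<open>u\<close> but not in the box below \<open>v\<close> lies
  in a slab \<open>v j < x j \<le> u j\<close> for some \<open>j\<close>. Uniform marginals bound
  the mass of each slab by its width.\<close>

lemma copula_le_add:
  assumes C: "copula k C" and u: "u \<in> unit_cube k" and v: "v \<in> unit_cube k"
  shows "C u \<le> C v + (\<Sum>j\<in>{1..k}. \<bar>u j - v j\<bar>)"
proof -
  from C obtain M where M: "prob_space M"
    "sets M = sets (Pi\<^sub>M {1..k} (\<lambda>_. restrict_space borel {0..1::real}))"
    and CM: "\<And>u. u\<in>unit_cube k \<Longrightarrow> C u = measure M {x \<in> space M. \<forall>j\<in>{1..k}. x j \<le> u j}"
    and unif: "\<And>j t. j\<in>{1..k} \<Longrightarrow> t\<in>{0..1} \<Longrightarrow> C (\<lambda>i\<in>{1..k}. if i = j then t else 1) = t"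
    unfolding copula_def by auto
  interpret M: prob_space M by fact
  have sp: "space M = ({1..k} \<rightarrow>\<^sub>E {0..1})"
    using sets_eq_imp_space_eq[OF M(2)] by (simp add: space_PiM space_restrict_space)
  have [measurable]: "(\<lambda>x. x j) \<in> borel_measurable M" if "j \<in> {1..k}" for j
  proof -
    have "(\<lambda>x. x j) \<in> Pi\<^sub>M {1..k} (\<lambda>_. restrict_space borel {0..1::real}) \<rightarrow>\<^sub>M restrict_space borel {0..1}"
      using that by (rule measurable_component_singleton)
    then show ?thesis
      unfolding measurable_cong_sets[OF M(2) refl] measurable_restrict_space2_iff by simp
  qed
  have marg: "measure M {x\<in>space M. x j \<le> t} = t" if j: "j \<in> {1..k}" and t: "t \<in> {0..1}" for j t
  proof -
    have "{x\<in>space M. x j \<le> t} =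
        {x \<in> space M. \<forall>i\<in>{1..k}. x i \<le> (\<lambda>i\<in>{1..k}. if i = j then t else 1) i}"
      using j by (auto simp: sp PiE_iff)
    then show ?thesis
      using unif[OF j t] CM[of "\<lambda>i\<in>{1..k}. if i = j then t else 1"] t by (simp add: unit_cube_def)
  qed
  let ?B = "\<lambda>u. {x \<in> space M. \<forall>j\<in>{1..k}. x j \<le> u j}"
  let ?S = "\<lambda>j. {x \<in> space M. v j < x j \<and> x j \<le> u j}"
  have slab: "measure M (?S j) \<le> \<bar>u j - v j\<bar>" if j: "j \<in> {1..k}" for j
  proof (cases "v j \<le> u j")
    case True
    have "?S j = {x\<in>space M. x j \<le> u j} - {x\<in>space M. x j \<le> v j}" by auto
    then have "measure M (?S j) = u j - v j"
      using True j u v by (simp, subst M.finite_measure_Diff) (auto simp: marg unit_cube_def PiE_iff)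
    then show ?thesis by simp
  next
    case False
    then have "?S j = {}" by auto
    then show ?thesis by (simp only: measure_empty abs_ge_zero)
  qed
  have "C u \<le> measure M (?B v \<union> (\<Union>j\<in>{1..k}. ?S j))"
    unfolding CM[OF u] by (intro M.finite_measure_mono) (auto simp: not_le)
  also have "\<dots> \<le> measure M (?B v) + measure M (\<Union>j\<in>{1..k}. ?S j)"
    by (intro measure_Un_le) auto
  also have "\<dots> \<le> C v + (\<Sum>j\<in>{1..k}. \<bar>u j - v j\<bar>)"
    unfolding CM[OF v]
    by (intro add_left_mono order.trans[OF measure_UNION_le] sum_mono slab) auto
  finally show ?thesis .
qed

text \<open>The open cube is dense in the closed one and copulas are continuous. The inequality is
  proved for an arbitrary ordered pair and then used in both directions.\<close>

lemma copula_eqI_interior: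
  assumes C: "copula k C" "copula k C'" and u: "u \<in> unit_cube k"
    and eq: "\<And>v. v \<in> {1..k} \<rightarrow>\<^sub>E {0<..<1} \<Longrightarrow> C v = C' v"
  shows "C u = C' u"
proof -
  have le: "C1 u \<le> C2 u"
    if C: "copula k C1" "copula k C2"
      and eq: "\<And>v. v \<in> {1..k} \<rightarrow>\<^sub>E {0<..<1} \<Longrightarrow> C1 v = C2 v" for C1 C2
  proof (rule field_le_epsilon)
    fix \<delta> :: real assume "0 < \<delta>"
    \<comment> \<open>Each of the two copulas contributes an error of at most
      \<open>k * \<epsilon>\<close>. The \<open>+ 1\<close> keeps the denominator positive for
      \<open>k = 0\<close>, and the cap 1/2 ensures \<open>\<epsilon> < 1\<close>.\<close>
    define \<epsilon> where "\<epsilon> = min (1/2) (\<delta> / (2 * real k + 1))"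
    have \<epsilon>: "0 < \<epsilon>" "\<epsilon> < 1"
      using \<open>0 < \<delta>\<close> by (auto simp: \<epsilon>_def min_less_iff_disj)
    have "\<epsilon> \<le> \<delta> / (2 * real k + 1)" by (simp add: \<epsilon>_def)
    then have "\<epsilon> * (2 * real k + 1) \<le> \<delta>" by (subst (asm) pos_le_divide_eq) auto
    then have le_\<delta>: "real k * \<epsilon> + real k * \<epsilon> \<le> \<delta>" using \<epsilon> by (simp add: algebra_simps)
    \<comment> \<open>The point \<open>u\<close> is moved towards the centre of the cube, all of
      whose coordinates are 1/2, and so off the boundary.\<close>
    define v where "v = (\<lambda>j\<in>{1..k}. (1 - \<epsilon>) * u j + \<epsilon> / 2)"
    have v01: "0 < v j \<and> v j < 1 \<and> \<bar>u j - v j\<bar> \<le> \<epsilon>" if j: "j \<in> {1..k}" for j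
    proof -
      have "0 \<le> u j" "u j \<le> 1" using u j by (auto simp: unit_cube_def PiE_iff)
      then have "0 \<le> (1 - \<epsilon>) * u j" "(1 - \<epsilon>) * u j \<le> 1 - \<epsilon>" "0 \<le> \<epsilon> * u j" "\<epsilon> * u j \<le> \<epsilon>"
        using \<epsilon> by (auto intro: mult_nonneg_nonneg mult_left_le)
      then show ?thesis
        using j \<epsilon> by (auto simp: v_def algebra_simps abs_le_iff)
    qed
    have v: "v \<in> {1..k} \<rightarrow>\<^sub>E {0<..<1}" "v \<in> unit_cube k"
      using v01 by (auto simp: v_def unit_cube_def PiE_iff less_imp_le)
    have "(\<Sum>j\<in>{1..k}. \<bar>u j - v j\<bar>) \<le> real k * \<epsilon>"
      using sum_bounded_above[of "{1..k}" "\<lambda>j. \<bar>u j - v j\<bar>" \<epsilon>] v01 by simp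
    moreover have "(\<Sum>j\<in>{1..k}. \<bar>v j - u j\<bar>) = (\<Sum>j\<in>{1..k}. \<bar>u j - v j\<bar>)"
      by (simp add: abs_minus_commute)
    ultimately show "C1 u \<le> C2 u + \<delta>"
      using copula_le_add[OF C(1) u v(2)] copula_le_add[OF C(2) v(2) u] eq[OF v(1)] le_\<delta>
      by linarith
  qed
  show ?thesis
    using le[OF C eq] le[OF C(2,1) eq[symmetric]] by (intro antisym) auto
qed

section \<open>Copulas of random vectors with uniform components\<close>

text \<open>The witness is the law of the vector. It has to live on the cube itself, so the
  components must take values in the unit interval everywhere, not just almost surely.\<close>

lemma (in prob_space) copula_joint_cdf:
  assumes [measurable]: "\<And>j. j \<in> {1..k} \<Longrightarrow> random_variable borel (U j)"
    and U01: "\<And>j z. j \<in> {1..k} \<Longrightarrow> z \<in> space M \<Longrightarrow> U j z \<in> {0..1}"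
    and unif: "\<And>j t. j \<in> {1..k} \<Longrightarrow> t \<in> {0..1} \<Longrightarrow> prob {z\<in>space M. U j z \<le> t} = t"
  shows "copula k (\<lambda>u. prob {z\<in>space M. \<forall>j\<in>{1..k}. U j z \<le> u j})"
proof -
  let ?R = "Pi\<^sub>M {1..k} (\<lambda>_. restrict_space borel {0..1::real})"
  let ?f = "\<lambda>z. \<lambda>j\<in>{1..k}. U j z"
  have f: "?f \<in> M \<rightarrow>\<^sub>M ?R"
    using U01 by (intro measurable_restrict measurable_restrict_space2) auto
  have C: "prob {z\<in>space M. \<forall>j\<in>{1..k}. U j z \<le> u j} =
      measure (distr M ?R ?f) {x \<in> space (distr M ?R ?f). \<forall>j\<in>{1..k}. x j \<le> u j}" for u
  proof -
    have [measurable]: "(\<lambda>x. x j) \<in> borel_measurable ?R" if "j \<in> {1..k}" for j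
      using measurable_component_singleton[OF that, of "\<lambda>_. restrict_space borel {0..1::real}"]
      by (simp add: measurable_restrict_space2_iff)
    have "{x\<in>space ?R. \<forall>j\<in>{1..k}. x j \<le> u j} \<in> sets ?R" by measurable
    then show ?thesis
      using f measurable_space[OF f]
      by (subst measure_distr) (auto intro!: arg_cong[where f=prob])
  qed
  have "prob {z\<in>space M. \<forall>i\<in>{1..k}. U i z \<le> (\<lambda>i\<in>{1..k}. if i = j then t else 1) i} = t"
    if "j \<in> {1..k}" "t \<in> {0..1}" for j t
  proof -
    have "{z\<in>space M. \<forall>i\<in>{1..k}. U i z \<le> (\<lambda>i\<in>{1..k}. if i = j then t else 1) i} =
        {z\<in>space M. U j z \<le> t}"
      using that U01 by auto
    then show ?thesis using unif[OF that] by simp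
  qed
  then show ?thesis
    unfolding copula_def using C f
    by (intro conjI exI[of _ "distr M ?R ?f"] prob_space_distr) auto
qed

section \<open>Marginal distribution functions\<close>

text \<open>Intermediate value theorem between the limits 0 and 1 at the two infinities. The levels
  0 and 1 themselves may be missed, hence the strict bounds on \<open>t\<close>.\<close>

lemma (in real_distribution) continuous_cdf_attains:
  assumes "continuous_on UNIV (cdf M)" "0 < t" "t < 1"
  obtains x where "cdf M x = t"
proof -
  have "eventually (\<lambda>x. cdf M x < t) at_bot" "eventually (\<lambda>x. t < cdf M x) at_top"
    using order_tendstoD(2)[OF cdf_lim_at_bot] order_tendstoD(1)[OF cdf_lim_at_top_prob] assms by auto
  then obtain a b where ab: "cdf M a < t" "t < cdf M b"
    by (meson eventually_at_bot_linorder eventually_at_top_linorder order_refl)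
  then have "a \<le> b" using cdf_nondecreasing[of b a] by force
  then obtain x where "cdf M x = t"
    using IVT'[of "cdf M" a t b] ab continuous_on_subset[OF assms(1)] by force
  then show thesis by (rule that)
qed

lemma real_distribution_marginal:
  fixes \<mu> :: "'h::{real_inner, second_countable_topology} measure"
  assumes "borel_prob \<mu>"
  shows "real_distribution (marginal e \<mu> j)"
proof -
  interpret prob_space \<mu> using assms by (simp add: borel_prob_def)
  show ?thesis
    using assms by (auto simp: marginal_def borel_prob_def cong: measurable_cong_sets)
qed

section \<open>Existence\<close>

lemma copulas_exist:
  fixes \<mu> :: "'h::{real_inner, complete_space, second_countable_topology} measure"
  assumes \<mu>: "borel_prob \<mu>"
  shows "\<exists>C. consistent_copulas C \<and> copulas_of e \<mu> C"
proof -
  interpret prob_space \<mu> using \<mu> by (simp add: borel_prob_def)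
  have [measurable_cong]: "sets \<mu> = sets borel" using \<mu> by (simp add: borel_prob_def)
  \<comment> \<open>The second component is one uniform variable shared by all coordinates and all
    \<open>k\<close>, so the \<open>C k\<close> below belong to initial segments of a single
    sequence \<open>U\<close>.\<close>
  define N where "N = \<mu> \<Otimes>\<^sub>M unit_lebesgue"
  interpret N: prob_space N
    unfolding N_def by (intro prob_space_pair prob_space_unit_lebesgue prob_space_axioms)
  define U where "U j z = distributional_transform (marginal e \<mu> j) (fst z \<bullet> e j) (snd z)" for j z
  have X: "random_variable borel (\<lambda>h. h \<bullet> e j)" for j by measurable
  have U[measurable]: "U j \<in> borel_measurable N" for j
    unfolding U_def N_def marginal_def by (rule measurable_uniformized[OF X])
  have U01: "U j z \<in> {0..1}" if "z \<in> space N" for j z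
    unfolding U_def using that
    by (intro real_distribution.distributional_transform_in_unit real_distribution_marginal[OF \<mu>])
       (auto simp: N_def space_pair_measure space_restrict_space)
  have unif: "measure N {z\<in>space N. U j z \<le> t} = t" if "t \<in> {0..1}" for j t
    unfolding U_def N_def marginal_def by (rule uniformized_uniform[OF X that])
  define C where "C k u = measure N {z\<in>space N. \<forall>j\<in>{1..k}. U j z \<le> u j}" for k :: nat and u
  have "copula k (C k)" for k
    unfolding C_def using U U01 unif by (intro N.copula_joint_cdf) auto
  \<comment> \<open>At level 1 the extra condition on \<open>U (Suc k)\<close> holds on all of
    \<open>space N\<close>, so the two events coincide.\<close>
  moreover have "C (Suc k) (u(Suc k := 1)) = C k u" for k u
    unfolding C_def using U01
    by (intro arg_cong[where f="measure N"]) (auto simp: atLeastAtMostSuc_conv)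
  ultimately have "consistent_copulas C" by (simp add: consistent_copulas_def)
  moreover have "copulas_of e \<mu> C"
    unfolding copulas_of_def
  proof (intro allI impI)
    fix k :: nat and I assume "\<forall>j\<in>{1..k}. I j \<in> lower_rays"
    then obtain x where x: "\<And>j. j \<in> {1..k} \<Longrightarrow> I j = {..x j}"
      unfolding lower_rays_def mem_Collect_eq by metis
    let ?A = "{h\<in>space \<mu>. \<forall>j\<in>{1..k}. h \<bullet> e j \<le> x j}"
    let ?N = "{z\<in>space N. \<forall>j\<in>{1..k}. fst z \<bullet> e j \<le> x j}"
    have PiE: "Pi\<^sub>E {1..k} I \<in> sets (Pi\<^sub>M {1..k} (\<lambda>_. borel))"
      using x by (intro sets_PiM_I_finite) auto
    have "proj e k \<in> \<mu> \<rightarrow>\<^sub>M Pi\<^sub>M {1..k} (\<lambda>_. borel)"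
      unfolding proj_def[abs_def] by measurable
    then have "measure (joint_law e \<mu> k) (Pi\<^sub>E {1..k} I) = measure \<mu> ?A"
      unfolding joint_law_def using PiE
      by (subst measure_distr)
         (auto simp: proj_def x PiE_iff simp del: PiE_UNIV_domain intro!: arg_cong[where f=prob])
    also have "\<dots> = measure N (?A \<times> {0..1})"
      unfolding N_def by (intro measure_Times_unit[symmetric] prob_space_axioms) measurable
    also have "?A \<times> {0..1} = ?N"
      by (auto simp: N_def space_pair_measure space_restrict_space)
    also have "measure N ?N = C k (\<lambda>j\<in>{1..k}. cdf (marginal e \<mu> j) (x j))"
    proof -
      \<comment> \<open>Each \<open>j\<close> has its own null set; their union is null because only
        finitely many \<open>j\<close> occur.\<close>
      have "AE z in N. \<forall>j\<in>{1..k}. U j z \<le> cdf (marginal e \<mu> j) (x j) \<longleftrightarrow> fst z \<bullet> e j \<le> x j"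
        unfolding U_def N_def marginal_def
        by (intro AE_finite_allI AE_uniformized_le_cdf_iff[OF X]) auto
      moreover have [measurable]: "?N \<in> sets N" unfolding N_def by measurable
      ultimately show ?thesis
        unfolding C_def by (intro N.finite_measure_eq_AE) auto
    qed
    also have "(\<lambda>j\<in>{1..k}. cdf (marginal e \<mu> j) (x j)) =
        (\<lambda>j\<in>{1..k}. measure (marginal e \<mu> j) (I j))"
      by (auto simp: cdf_def x)
    finally show "measure (joint_law e \<mu> k) (Pi\<^sub>E {1..k} I) =
        C k (\<lambda>j\<in>{1..k}. measure (marginal e \<mu> j) (I j))" .
  qed
  ultimately show ?thesis by blast
qed

section \<open>Uniqueness\<close>

text \<open>Every point of the open cube is a vector of marginal cdf values, so there the copula
  equals the joint law of a rectangle; \<open>copula_eqI_interior\<close> extends the agreement to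
  the boundary.\<close>

lemma copulas_unique:
  fixes \<mu> :: "'h::{real_inner, second_countable_topology} measure"
  assumes \<mu>: "\<mu> \<in> continuous_marginal_measures e"
    and C: "consistent_copulas C" "copulas_of e \<mu> C"
    and C': "consistent_copulas C'" "copulas_of e \<mu> C'"
    and k: "k \<ge> 1" and u: "u \<in> unit_cube k"
  shows "C k u = C' k u"
proof (rule copula_eqI_interior[OF _ _ u])
  show "copula k (C k)" "copula k (C' k)"
    using C C' k by (auto simp: consistent_copulas_def)
  fix v :: "nat \<Rightarrow> real" assume v: "v \<in> {1..k} \<rightarrow>\<^sub>E {0<..<1}"
  have "\<exists>x. cdf (marginal e \<mu> j) x = v j" if j: "j \<in> {1..k}" for j
  proof -
    interpret real_distribution "marginal e \<mu> j"
      using \<mu> by (intro real_distribution_marginal) (simp add: continuous_marginal_measures_def)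
    have "continuous_on UNIV (cdf (marginal e \<mu> j))"
      using \<mu> j by (simp add: continuous_marginal_measures_def cdf_def[abs_def])
    then show ?thesis
      using v j by (elim continuous_cdf_attains[of "v j"]) (auto simp: PiE_iff)
  qed
  then obtain x where x: "\<forall>j\<in>{1..k}. cdf (marginal e \<mu> j) (x j) = v j"
    using bchoice[of "{1..k}" "\<lambda>j x. cdf (marginal e \<mu> j) x = v j"] by blast
  \<comment> \<open>Equality holds outside \<open>{1..k}\<close> as well, since both functions are
    extensional; this allows rewriting the argument of \<open>C k\<close>.\<close>
  have v_eq: "v = (\<lambda>j\<in>{1..k}. measure (marginal e \<mu> j) {..x j})"
  proof
    show "v j = (\<lambda>j\<in>{1..k}. measure (marginal e \<mu> j) {..x j}) j" for j
      using v x by (cases "j \<in> {1..k}") (auto simp: cdf_def PiE_iff extensional_def)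
  qed
  \<comment> \<open>The right side depends on \<open>\<mu>\<close> and \<open>x\<close> only, not on
    the family \<open>B\<close>.\<close>
  have rect: "B k v = measure (joint_law e \<mu> k) (Pi\<^sub>E {1..k} (\<lambda>j. {..x j}))"
    if "copulas_of e \<mu> B" for B
    unfolding v_eq using that k by (auto simp: copulas_of_def lower_rays_def)
  show "C k v = C' k v" by (simp only: rect[OF C(2)] rect[OF C'(2)])
qed

theorem theorem3p2:
  fixes e :: "nat \<Rightarrow> 'h::{real_inner, complete_space, second_countable_topology}"
    and \<mu> :: "'h measure"
  assumes "orthonormal_basis e"
    and "borel_prob \<mu>"
  shows "(\<exists>C. consistent_copulas C \<and> copulas_of e \<mu> C) \<and>
    (\<mu> \<in> continuous_marginal_measures e \<longrightarrow>
      (\<forall>C C'. consistent_copulas C \<and> copulas_of e \<mu> C \<and>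
              consistent_copulas C' \<and> copulas_of e \<mu> C' \<longrightarrow>
              (\<forall>k\<ge>1. \<forall>u\<in>unit_cube k. C k u = C' k u)))"
proof (intro conjI impI allI ballI)
  show "\<exists>C. consistent_copulas C \<and> copulas_of e \<mu> C"
    using assms(2) by (rule copulas_exist)
  show "C k u = C' k u"
    if "\<mu> \<in> continuous_marginal_measures e"
      "consistent_copulas C \<and> copulas_of e \<mu> C \<and> consistent_copulas C' \<and> copulas_of e \<mu> C'"
      "1 \<le> k" "u \<in> unit_cube k" for C C' k u
    using that by (elim conjE) (rule copulas_unique)
qed

end
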